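(* Let $\mathfrak{A}$ be a residuated lattice. The following assertions are equivalent: (1) $\mathfrak{A}$ is Gelfand; (2) $\rho(F)\subseteq \mathfrak{m}$ implies $F\subseteq \mathfrak{m}$, for any filter $F$ and any maximal filter $\mathfrak{m}$ of $\mathfrak{A}$; (3) $Max(\mathfrak{A})\cap h(F)=Max(\mathfrak{A})\cap h(\rho(F))$, for any filter $F$ of $\mathfrak{A}$; (4) $Rad(F)=Rad(\rho(F))$, for any filter $F$ of $\mathfrak{A}$; (5) if $F$ and $G$ are comaximal filters of $\mathfrak{A}$, then so are $\rho(F)$ and $\rho(G)$; (6) if $\mathcal{F}$ is a family of filters of $\mathfrak{A}$, then $\rho(\veebar\mathcal{F})=\veebar_{F\in \mathcal{F}}\rho(F)$; (7) if $\mathfrak{m}$ and $\mathfrak{n}$ are distinct maximal filters of $\mathfrak{A}$, then $\rho(\mathfrak{m})$ and $\rho(\mathfrak{n})$ are comaximal.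
   Context: A residuated lattice is an algebra $\mathfrak{A}=(A;\vee,\wedge,\odot,\rightarrow,0,1)$ such that $(A;\vee,\wedge,0,1)$ is a bounded lattice, $(A;\odot,1)$ is a commutative monoid, and $x\odot y\le z$ iff $x\le y\rightarrow z$ for all $x,y,z\in A$. A filter of $\mathfrak{A}$ is a non-empty subset $F\subseteq A$ such that $x,y\in F$ implies $x\odot y\in F$, and $x\in F$, $y\in A$ imply $x\vee y\in F$. For a family $\mathcal{F}$ of filters, $\veebar\mathcal{F}$ is the filter generated by $\bigcup\mathcal{F}$ (binary version: $F\veebar G$); $F,G$ are comaximal if $F\veebar G=A$. A filter is proper if it is not $A$; a maximal filter is a maximal element (under inclusion) among proper filters; a prime filter is a proper filter $\mathfrak{p}$ such that $x\vee y\in\mathfrak{p}$ implies $x\in\mathfrak{p}$ or $y\in\mathfrak{p}$. $Spec(\mathfrak{A})$ and $Max(\mathfrak{A})$ are the sets of prime and maximal filters; $Max(\mathfrak{A})\subseteq Spec(\mathfrak{A})$. $\mathfrak{A}$ is Gelfand if every prime filter is contained in a unique maximal filter. For $X\subseteq A$, $h(X)=\{\mathfrak{p}\in Spec(\mathfrak{A})\mid X\subseteq\mathfrak{p}\}$. $Rad(F)$ is the intersection of all maximal filters containing $F$ (an empty intersection is $A$). For a filter $F$, $\sigma(F)$ is the intersection of all prime filters $\mathfrak{q}$ such that $\mathfrak{q}\subseteq\mathfrak{p}$ for some $\mathfrak{p}\in h(F)$ (an empty intersection is $A$); equivalently $\sigma(F)=\{a\in A\mid F\veebar a^{\perp}=A\}$,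 where $a^{\perp}=\{x\in A\mid x\vee a=1\}$. $\sigma(F)$ is a filter contained in $F$. $F$ is pure if $\sigma(F)=F$. The join $\veebar$ of any family of pure filters is pure, and the pure part of a filter $F$ is $\rho(F)=\veebar\{G\mid G\text{ a pure filter of }\mathfrak{A},\ G\subseteq F\}$, the largest pure filter contained in $F$. *)

theory Defs
  imports Main "HOL.Hull"
begin

text \<open>
  The carrier is the whole type. \<open>\<vee>\<close>, \<open>\<wedge>\<close>, \<open>0\<close> are \<open>sup\<close>, \<open>inf\<close>, \<open>bot\<close>; the monoid operation
  \<open>\<odot>\<close> is \<open>*\<close>, and its unit \<open>1\<close> is identified with the greatest element \<open>top\<close>. The degenerate
  structure with \<open>bot = top\<close> is allowed.
\<close>

class residuated_lattice = bounded_lattice + comm_monoid_mult +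
  fixes residuum :: "'a \<Rightarrow> 'a \<Rightarrow> 'a"  (infixr "\<leadsto>" 60)
  assumes one_eq_top: "1 = top"
    and residuation: "x * y \<le> z \<longleftrightarrow> x \<le> y \<leadsto> z"

definition rl_filter :: "'a::residuated_lattice set \<Rightarrow> bool" where
  "rl_filter F \<longleftrightarrow>
     F \<noteq> {} \<and> (\<forall>x\<in>F. \<forall>y\<in>F. x * y \<in> F) \<and> (\<forall>x\<in>F. \<forall>y. sup x y \<in> F)"

definition filter_Join :: "'a::residuated_lattice set set \<Rightarrow> 'a set" where
  "filter_Join \<F> = rl_filter hull (\<Union>\<F>)"

definition comaximal :: "'a::residuated_lattice set \<Rightarrow> 'a set \<Rightarrow> bool" where
  "comaximal F G \<longleftrightarrow> filter_Join {F, G} = UNIV"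

definition proper_filter :: "'a::residuated_lattice set \<Rightarrow> bool" where
  "proper_filter F \<longleftrightarrow> rl_filter F \<and> F \<noteq> UNIV"

definition prime_filters :: "'a::residuated_lattice set set" where
  "prime_filters =
     {P. proper_filter P \<and> (\<forall>x y. sup x y \<in> P \<longrightarrow> x \<in> P \<or> y \<in> P)}"

definition maximal_filters :: "'a::residuated_lattice set set" where
  "maximal_filters =
     {M. proper_filter M \<and> (\<forall>N. proper_filter N \<and> M \<subseteq> N \<longrightarrow> N = M)}"

text \<open>Being Gelfand is a property of the structure, hence of the type.\<close>

definition gelfand :: "'a::residuated_lattice itself \<Rightarrow> bool" where
  "gelfand _ \<longleftrightarrow>
     (\<forall>P \<in> (prime_filters :: 'a set set). \<exists>!M. M \<in> maximal_filters \<and> P \<subseteq> M)"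

definition hull_primes :: "'a::residuated_lattice set \<Rightarrow> 'a set set" where
  "hull_primes X = {P \<in> prime_filters. X \<subseteq> P}"

definition Rad :: "'a::residuated_lattice set \<Rightarrow> 'a set" where
  "Rad F = \<Inter>{M \<in> maximal_filters. F \<subseteq> M}"

definition sigma :: "'a::residuated_lattice set \<Rightarrow> 'a set" where
  "sigma F = \<Inter>{Q \<in> prime_filters. \<exists>P \<in> hull_primes F. Q \<subseteq> P}"

definition pure_filter :: "'a::residuated_lattice set \<Rightarrow> bool" where
  "pure_filter F \<longleftrightarrow> rl_filter F \<and> sigma F = F"

definition pure_part :: "'a::residuated_lattice set \<Rightarrow> 'a set" where
  "pure_part F = filter_Join {G. pure_filter G \<and> G \<subseteq> F}"

end

theory Submission
  imports Defs
begin

text \<open>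
  The proof compares two ways to shrink a filter \<open>F\<close>: \<open>sigma F\<close>, which is given by the primes lying
  below primes over \<open>F\<close>, and \<open>pure_part F\<close>, the largest filter inside \<open>F\<close> that \<open>sigma\<close> fixes. Always
  \<open>pure_part F \<subseteq> sigma F \<subseteq> F\<close>: the first inclusion because \<open>sigma\<close> is monotone, the second because a
  filter is the intersection of the primes over it.

  The inclusion \<open>pure_part M \<subseteq> sigma M\<close> says that \<open>pure_part M\<close> lies in every prime below \<open>M\<close>. So if a
  prime lies below two maximal filters, it contains both of their pure parts, and these cannot
  be comaximal. Hence the separation of distinct maximal filters by their pure parts makes
  the lattice Gelfand.

  Conversely, let the lattice be Gelfand. If \<open>M\<close> is maximal and \<open>F\<close> is not contained in \<open>M\<close>,
  then \<open>sigma F\<close> is not contained in \<open>M\<close> either (\<open>gelfand_sigma_subset_maximal\<close>). Otherwise \<open>F\<close>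
  together with all elements \<open>d\<close> having some \<open>a \<notin> M\<close> with \<open>a \<squnion> d = 1\<close> would generate a
  proper filter. A maximal filter \<open>N\<close> above it differs from \<open>M\<close>, and by the choice of
  these \<open>d\<close> no join of an element outside \<open>M\<close> with an element outside \<open>N\<close> equals \<open>1\<close>. The
  separation theorem (\<open>prime_filter_avoiding\<close>) then yields a prime below both \<open>M\<close> and \<open>N\<close>.
  It follows that \<open>F\<close> and \<open>sigma F\<close> lie in the same maximal filters. In a Gelfand lattice the
  maximal filters over \<open>F\<close> determine \<open>sigma F\<close>, so \<open>sigma F\<close> is pure and thus equals
  \<open>pure_part F\<close>. This shows that \<open>F\<close> and \<open>pure_part F\<close> lie in the same maximal filters; the other
  conditions either restate this or sit between it and the separation of maximal filters.
\<close>

section \<open>Arithmetic of residuated lattices\<close>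

lemma mult_le_mono:
  fixes x y u v :: "'a::residuated_lattice"
  assumes "x \<le> y" and "u \<le> v"
  shows "x * u \<le> y * v"
proof -
  have right: "a * c \<le> b * c" if "a \<le> b" for a b c :: 'a
    using that residuation[of b c "b * c"] residuation[of a c "b * c"] by auto
  show ?thesis
    using right[OF assms(1), of u] right[OF assms(2), of y] by (simp add: mult.commute)
qed

lemma le_one: "(x::'a::residuated_lattice) \<le> 1"
  by (simp add: one_eq_top)

lemma sup_one_left: "sup 1 (x::'a::residuated_lattice) = 1"
  by (simp add: le_one sup_absorb1)

lemma sup_mult_le:
  fixes x y z w :: "'a::residuated_lattice"
  assumes "x * z \<le> w" and "y * z \<le> w"
  shows "sup x y * z \<le> w"
  using assms by (simp add: residuation)

text \<open>
  Multiplying out the left side gives \<open>a * b\<close> and three further products, each with a factor \<open>x\<close>. This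
  inequality takes the place of distributivity, which the underlying lattice may lack.
\<close>

lemma sup_mult_sup_le:
  fixes x a b :: "'a::residuated_lattice"
  shows "sup a x * sup b x \<le> sup (a * b) x"
proof -
  have le: "x * c \<le> sup d x" "c * x \<le> sup d x" for c d :: 'a
    using mult_le_mono[of x x c 1] mult_le_mono[of c 1 x x] le_one le_supI2 by auto
  have "sup b x * a \<le> sup (a * b) x"
    by (rule sup_mult_le) (auto simp: le mult.commute)
  then show ?thesis
    by (intro sup_mult_le le) (simp add: mult.commute)
qed

section \<open>Filters\<close>

lemma filter_mult: "rl_filter F \<Longrightarrow> x \<in> F \<Longrightarrow> y \<in> F \<Longrightarrow> x * y \<in> F"
  by (simp add: rl_filter_def)

lemma filter_upward: "rl_filter F \<Longrightarrow> x \<in> F \<Longrightarrow> x \<le> y \<Longrightarrow> y \<in> F"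
  unfolding rl_filter_def by (metis sup.absorb2)

lemma one_in_filter: "rl_filter F \<Longrightarrow> 1 \<in> F"
  using filter_upward[OF _ _ le_one] by (metis ex_in_conv rl_filter_def)

lemma rl_filterI:
  assumes "1 \<in> F" and "\<And>x y. x \<in> F \<Longrightarrow> y \<in> F \<Longrightarrow> x * y \<in> F"
    and "\<And>x y. x \<in> F \<Longrightarrow> x \<le> y \<Longrightarrow> y \<in> F"
  shows "rl_filter F"
  unfolding rl_filter_def using assms sup_ge1 by blast

lemma filter_bot_iff: "rl_filter F \<Longrightarrow> bot \<in> F \<longleftrightarrow> F = UNIV"
  using filter_upward bot_least by blast

lemma proper_filter_iff: "proper_filter F \<longleftrightarrow> rl_filter F \<and> bot \<notin> F"
  unfolding proper_filter_def using filter_bot_iff by blast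

lemma filter_UNIV: "rl_filter UNIV"
  by (auto simp: rl_filter_def)

lemma filter_singleton_one: "rl_filter {1::'a::residuated_lattice}"
  by (rule rl_filterI) (auto simp: order.antisym le_one)

lemma filter_Inter:
  assumes "\<And>F. F \<in> \<F> \<Longrightarrow> rl_filter F"
  shows "rl_filter (\<Inter>\<F>)"
  by (rule rl_filterI) (use assms one_in_filter filter_mult filter_upward in blast)+

lemma filter_chain_Union:
  assumes "\<C> \<noteq> {}" and filt: "\<And>F. F \<in> \<C> \<Longrightarrow> rl_filter F"
    and chain: "\<And>F G. F \<in> \<C> \<Longrightarrow> G \<in> \<C> \<Longrightarrow> F \<subseteq> G \<or> G \<subseteq> F"
  shows "rl_filter (\<Union>\<C>)"
proof (rule rl_filterI)
  show "1 \<in> \<Union>\<C>" using assms(1) filt one_in_filter by blast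
next
  fix x y assume "x \<in> \<Union>\<C>" and "y \<in> \<Union>\<C>"
  then obtain F G where FG: "F \<in> \<C>" "G \<in> \<C>" "x \<in> F" "y \<in> G" by blast
  from chain[OF FG(1,2)] show "x * y \<in> \<Union>\<C>"
    using FG filt filter_mult by blast
next
  fix x y assume "x \<in> \<Union>\<C>" and "x \<le> y"
  then show "y \<in> \<Union>\<C>" using filt filter_upward by blast
qed

text \<open>
  Passing from \<open>F\<close> to this larger filter adjoins \<open>x\<close> whenever \<open>sup x y \<in> F\<close>. It replaces the filter
  generated by \<open>F\<close> and \<open>x\<close> in primality arguments and avoids powers of \<open>x\<close>.
\<close>

lemma filter_sup_residual:
  assumes "rl_filter F"
  shows "rl_filter {z. sup z y \<in> F}"
proof (rule rl_filterI)
  show "1 \<in> {z. sup z y \<in> F}"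
    using one_in_filter[OF assms] by (simp add: sup_one_left)
  show "a * b \<in> {z. sup z y \<in> F}"
    if "a \<in> {z. sup z y \<in> F}" "b \<in> {z. sup z y \<in> F}" for a b
    using that filter_upward[OF assms _ sup_mult_sup_le] filter_mult[OF assms] by blast
  show "b \<in> {z. sup z y \<in> F}" if "a \<in> {z. sup z y \<in> F}" "a \<le> b" for a b
    using that filter_upward[OF assms, of "sup a y" "sup b y"] by (simp add: sup.mono le_supI1)
qed

lemma filter_products_above:
  assumes "rl_filter F" and "rl_filter G"
  shows "rl_filter {z. \<exists>f\<in>F. \<exists>g\<in>G. f * g \<le> z}"
proof (rule rl_filterI)
  show "1 \<in> {z. \<exists>f\<in>F. \<exists>g\<in>G. f * g \<le> z}"
    using one_in_filter[OF assms(1)] one_in_filter[OF assms(2)] le_one by blast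
  fix x y
  assume x: "x \<in> {z. \<exists>f\<in>F. \<exists>g\<in>G. f * g \<le> z}"
  show "y \<in> {z. \<exists>f\<in>F. \<exists>g\<in>G. f * g \<le> z}" if "x \<le> y"
    using x order_trans[OF _ that] by blast
  assume "y \<in> {z. \<exists>f\<in>F. \<exists>g\<in>G. f * g \<le> z}"
  then obtain f g f' g' where mem: "f \<in> F" "g \<in> G" "f' \<in> F" "g' \<in> G"
    and "f * g \<le> x" "f' * g' \<le> y"
    using x by blast
  then have "(f * f') * (g * g') \<le> x * y"
    using mult_le_mono[of "f * g" x "f' * g'" y] by (simp add: ac_simps)
  then show "x * y \<in> {z. \<exists>f\<in>F. \<exists>g\<in>G. f * g \<le> z}"
    using mem filter_mult[OF assms(1), of f f'] filter_mult[OF assms(2), of g g'] by blast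
qed

lemma filter_filter_Join: "rl_filter (filter_Join \<F>)"
  unfolding filter_Join_def by (rule hull_in) (simp add: filter_Inter)

lemma filter_Join_upper: "F \<in> \<F> \<Longrightarrow> F \<subseteq> filter_Join \<F>"
  unfolding filter_Join_def using hull_subset[of "\<Union>\<F>" rl_filter] by blast

lemma filter_Join_least:
  assumes "\<And>F. F \<in> \<F> \<Longrightarrow> F \<subseteq> G" and "rl_filter G"
  shows "filter_Join \<F> \<subseteq> G"
  unfolding filter_Join_def by (intro hull_minimal Union_least assms)

section \<open>Prime and maximal filters\<close>

lemma maximal_filter_avoiding:
  assumes "rl_filter F" and "F \<inter> S = {}"
  obtains P where "rl_filter P" and "F \<subseteq> P" and "P \<inter> S = {}"
    and "\<forall>Q. rl_filter Q \<and> P \<subseteq> Q \<and> Q \<inter> S = {} \<longrightarrow> Q = P"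
proof -
  let ?A = "{Q. rl_filter Q \<and> F \<subseteq> Q \<and> Q \<inter> S = {}}"
  have "?A \<noteq> {}" using assms by blast
  moreover have "\<Union>\<C> \<in> ?A" if "\<C> \<noteq> {}" "subset.chain ?A \<C>" for \<C>
  proof -
    have "F \<subseteq> G \<or> G \<subseteq> F" if "F \<in> \<C>" "G \<in> \<C>" for F G
      using that \<open>subset.chain ?A \<C>\<close> unfolding subset.chain_def by blast
    moreover have "rl_filter F" if "F \<in> \<C>" for F
      using that \<open>subset.chain ?A \<C>\<close> unfolding subset.chain_def by blast
    ultimately have "rl_filter (\<Union>\<C>)"
      using filter_chain_Union \<open>\<C> \<noteq> {}\<close> by blast
    then show ?thesis using that unfolding subset.chain_def by blast
  qed
  ultimately have "\<exists>P\<in>?A. \<forall>Q\<in>?A. P \<subseteq> Q \<longrightarrow> Q = P"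
    by (rule subset_Zorn_nonempty)
  then obtain P where P: "P \<in> ?A" and max: "\<forall>Q\<in>?A. P \<subseteq> Q \<longrightarrow> Q = P" by blast
  then have "\<forall>Q. rl_filter Q \<and> P \<subseteq> Q \<and> Q \<inter> S = {} \<longrightarrow> Q = P" by blast
  then show thesis using that P by blast
qed

text \<open>
  A filter that is maximal among those avoiding \<open>S\<close> is prime. If \<open>sup x y\<close> belongs to it but
  neither \<open>x\<close> nor \<open>y\<close> does, then enlarging it twice by \<open>filter_sup_residual\<close> produces two elements
  of \<open>S\<close> whose join lies in the filter.
\<close>

lemma prime_filter_avoiding:
  assumes "rl_filter F" and "F \<inter> S = {}" and "S \<noteq> {}"
    and sup_closed: "\<And>s t. s \<in> S \<Longrightarrow> t \<in> S \<Longrightarrow> sup s t \<in> S"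
  obtains P where "P \<in> prime_filters" and "F \<subseteq> P" and "P \<inter> S = {}"
proof -
  obtain P where P: "rl_filter P" "F \<subseteq> P" "P \<inter> S = {}"
    and max: "\<forall>Q. rl_filter Q \<and> P \<subseteq> Q \<and> Q \<inter> S = {} \<longrightarrow> Q = P"
    using maximal_filter_avoiding[OF assms(1,2)] .
  have meets: "\<exists>s\<in>S. sup s y \<in> P" if "sup x y \<in> P" "x \<notin> P" for x y
  proof -
    have "P \<subseteq> {z. sup z y \<in> P}" using P(1) by (auto simp: rl_filter_def)
    then show ?thesis
      using max filter_sup_residual[OF P(1), of y] that by blast
  qed
  have "x \<in> P \<or> y \<in> P" if xy: "sup x y \<in> P" for x y
  proof (rule ccontr)
    assume not: "\<not> (x \<in> P \<or> y \<in> P)"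
    then obtain s where s: "s \<in> S" "sup y s \<in> P"
      using meets[OF xy] by (auto simp: sup_commute)
    then obtain t where "t \<in> S" "sup t s \<in> P" using meets[of y s] not by blast
    then show False using s sup_closed P(3) by blast
  qed
  moreover have "P \<noteq> UNIV" using P(3) assms(3) by blast
  ultimately have "P \<in> prime_filters"
    using P(1) by (simp add: prime_filters_def proper_filter_def)
  then show thesis using that P by blast
qed

lemma prime_filterD:
  assumes "P \<in> prime_filters"
  shows "rl_filter P" and "bot \<notin> P" and "sup x y \<in> P \<Longrightarrow> x \<in> P \<or> y \<in> P"
  using assms by (auto simp: prime_filters_def proper_filter_iff)

lemma proper_filter_subset_maximal:
  assumes "rl_filter F" and "F \<noteq> UNIV"
  obtains M where "M \<in> maximal_filters" and "F \<subseteq> M"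
proof -
  have "F \<inter> {bot} = {}" using assms filter_bot_iff by blast
  obtain M where "rl_filter M" "F \<subseteq> M" "M \<inter> {bot} = {}"
    "\<forall>Q. rl_filter Q \<and> M \<subseteq> Q \<and> Q \<inter> {bot} = {} \<longrightarrow> Q = M"
    using maximal_filter_avoiding[OF assms(1) \<open>F \<inter> {bot} = {}\<close>] .
  then have "M \<in> maximal_filters" and "F \<subseteq> M"
    by (auto simp: maximal_filters_def proper_filter_iff)
  then show thesis by (rule that)
qed

lemma maximal_filterD:
  assumes "M \<in> maximal_filters"
  shows "rl_filter M" and "bot \<notin> M"
    and "rl_filter F \<Longrightarrow> F \<noteq> UNIV \<Longrightarrow> M \<subseteq> F \<Longrightarrow> F = M"
proof -
  have "proper_filter M" and max: "\<forall>N. proper_filter N \<and> M \<subseteq> N \<longrightarrow> N = M"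
    using assms by (simp_all add: maximal_filters_def)
  then show "rl_filter M" "bot \<notin> M" by (simp_all add: proper_filter_iff)
  show "F = M" if "rl_filter F" "F \<noteq> UNIV" "M \<subseteq> F"
    using max that by (simp add: proper_filter_def)
qed

lemma maximal_filter_prime:
  assumes "M \<in> maximal_filters"
  shows "M \<in> prime_filters"
proof -
  obtain P where "P \<in> prime_filters" "M \<subseteq> P"
    by (rule prime_filter_avoiding[of M "{bot}"]) (use maximal_filterD[OF assms] in auto)
  then show ?thesis
    using maximal_filterD(3)[OF assms, of P] prime_filterD(1,2)[of P] by auto
qed

lemma prime_filter_subset_maximal:
  assumes "P \<in> prime_filters"
  obtains M where "M \<in> maximal_filters" and "P \<subseteq> M"
proof (rule proper_filter_subset_maximal)
  show "rl_filter P" "P \<noteq> UNIV" using prime_filterD(1,2)[OF assms] by auto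
qed

lemma gelfand_maximal_unique:
  assumes "gelfand TYPE('a::residuated_lattice)" and "(P::'a set) \<in> prime_filters"
    and "M \<in> maximal_filters" "P \<subseteq> M" "N \<in> maximal_filters" "P \<subseteq> N"
  shows "M = N"
  using assms unfolding gelfand_def by (metis (no_types))

lemma gelfandI:
  assumes "\<And>(P::'a::residuated_lattice set) M N. P \<in> prime_filters \<Longrightarrow> M \<in> maximal_filters \<Longrightarrow>
    N \<in> maximal_filters \<Longrightarrow> P \<subseteq> M \<Longrightarrow> P \<subseteq> N \<Longrightarrow> M = N"
  shows "gelfand TYPE('a)"
  unfolding gelfand_def
proof (intro ballI ex_ex1I)
  fix P :: "'a set" assume "P \<in> prime_filters"
  then obtain M where "M \<in> maximal_filters" "P \<subseteq> M" by (rule prime_filter_subset_maximal)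
  then show "\<exists>M. M \<in> maximal_filters \<and> P \<subseteq> M" by blast
next
  fix P M N :: "'a set"
  assume "P \<in> prime_filters" "M \<in> maximal_filters \<and> P \<subseteq> M" "N \<in> maximal_filters \<and> P \<subseteq> N"
  then show "M = N" using assms[of P M N] by simp
qed

text \<open>
  A prime below both \<open>P\<close> and \<open>Q\<close> has to avoid all joins of an element outside \<open>P\<close> with one
  outside \<open>Q\<close>. By primality of \<open>P\<close> and \<open>Q\<close> these joins are closed under \<open>sup\<close>, so the only obstruction
  is that one of them equals \<open>1\<close>.
\<close>

lemma common_prime_below:
  assumes P: "P \<in> prime_filters" and Q: "Q \<in> prime_filters"
    and no_split: "\<And>c d. sup c d = 1 \<Longrightarrow> c \<notin> P \<Longrightarrow> d \<in> Q"
  obtains R where "R \<in> prime_filters" and "R \<subseteq> P" and "R \<subseteq> Q"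
proof -
  let ?S = "{sup c d | c d. c \<notin> P \<and> d \<notin> Q}"
  have "1 \<notin> ?S"
  proof
    assume "1 \<in> ?S"
    then obtain c d where "sup c d = 1" "c \<notin> P" "d \<notin> Q" by force
    then show False using no_split by blast
  qed
  then have "{1} \<inter> ?S = {}" by simp
  moreover have "?S \<noteq> {}" using prime_filterD(2)[OF P] prime_filterD(2)[OF Q] by blast
  moreover have "sup s t \<in> ?S" if "s \<in> ?S" "t \<in> ?S" for s t
  proof -
    obtain c d c' d' where st: "s = sup c d" "t = sup c' d'"
      and out: "c \<notin> P" "d \<notin> Q" "c' \<notin> P" "d' \<notin> Q"
      using \<open>s \<in> ?S\<close> \<open>t \<in> ?S\<close> by blast
    have "sup s t = sup (sup c c') (sup d d')" by (simp add: st ac_simps)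
    moreover have "sup c c' \<notin> P" "sup d d' \<notin> Q"
      using out prime_filterD(3)[OF P] prime_filterD(3)[OF Q] by blast+
    ultimately show ?thesis by blast
  qed
  ultimately obtain R where R: "R \<in> prime_filters" "R \<inter> ?S = {}"
    by (rule prime_filter_avoiding[OF filter_singleton_one, of ?S])
  have "r \<in> P \<and> r \<in> Q" if "r \<in> R" for r
  proof (rule ccontr)
    assume not: "\<not> (r \<in> P \<and> r \<in> Q)"
    \<comment> \<open>Since \<open>bot\<close> lies outside both filters, \<open>r\<close> itself is a forbidden join.\<close>
    have "sup r bot \<in> ?S \<or> sup bot r \<in> ?S"
      using not prime_filterD(2)[OF P] prime_filterD(2)[OF Q] by blast
    then show False using R(2) that by (simp only: sup_bot_right sup_bot_left) blast
  qed
  then show thesis using that R(1) by blast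
qed

section \<open>The operator sigma and the pure part\<close>

lemma filter_sigma: "rl_filter (sigma F)"
  unfolding sigma_def by (rule filter_Inter) (auto intro: prime_filterD(1))

lemma sigma_mono: "F \<subseteq> G \<Longrightarrow> sigma F \<subseteq> sigma G"
  unfolding sigma_def hull_primes_def by (rule Inter_anti_mono) blast

lemma sigma_subset_prime:
  assumes "Q \<in> prime_filters" and "P \<in> prime_filters" and "Q \<subseteq> P" and "F \<subseteq> P"
  shows "sigma F \<subseteq> Q"
  unfolding sigma_def hull_primes_def by (rule Inter_lower) (use assms in blast)

lemma subset_sigmaI:
  assumes "\<And>P Q. Q \<in> prime_filters \<Longrightarrow> P \<in> prime_filters \<Longrightarrow> Q \<subseteq> P \<Longrightarrow> F \<subseteq> P \<Longrightarrow> X \<subseteq> Q"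
  shows "X \<subseteq> sigma F"
  unfolding sigma_def hull_primes_def by (rule Inter_greatest) (use assms in blast)

text \<open>A filter is the intersection of the primes that contain it, and \<open>sigma F\<close> lies in all of them.\<close>

lemma sigma_subset:
  assumes "rl_filter F"
  shows "sigma F \<subseteq> F"
proof
  fix a assume a: "a \<in> sigma F"
  show "a \<in> F"
  proof (rule ccontr)
    assume "a \<notin> F"
    then obtain P where "P \<in> prime_filters" "F \<subseteq> P" "a \<notin> P"
      using prime_filter_avoiding[OF assms, of "{a}"] by auto
    then show False using sigma_subset_prime[of P P F] a by blast
  qed
qed

text \<open>
  The two equations say that \<open>F\<close> and the co-annihilator of \<open>a\<close> are comaximal. No prime over \<open>F\<close>
  contains \<open>b\<close>, so a prime below one does not contain \<open>b\<close> either and has to contain \<open>a\<close>.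
\<close>

lemma in_sigmaI:
  assumes "f \<in> F" and "f * b = bot" and "sup a b = 1"
  shows "a \<in> sigma F"
proof -
  have "{a} \<subseteq> Q" if Q: "Q \<in> prime_filters" and P: "P \<in> prime_filters" and "Q \<subseteq> P" "F \<subseteq> P" for P Q
  proof -
    have "b \<notin> P" using filter_mult[of P f b] prime_filterD[OF P] assms(1,2) that(4) by auto
    moreover have "sup a b \<in> Q" using one_in_filter prime_filterD(1)[OF Q] assms(3) by simp
    ultimately show ?thesis using prime_filterD(3)[OF Q] that(3) by blast
  qed
  then show ?thesis using subset_sigmaI[of F "{a}"] by blast
qed

lemma pure_filterI: "rl_filter F \<Longrightarrow> F \<subseteq> sigma F \<Longrightarrow> pure_filter F"
  using sigma_subset by (auto simp: pure_filter_def)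

lemma pure_filter_UNIV: "pure_filter UNIV"
  by (intro pure_filterI subset_sigmaI filter_UNIV) (use prime_filterD(2) in blast)

text \<open>By monotonicity, \<open>sigma\<close> of the join is a filter containing every member of the family.\<close>

lemma pure_filter_Join:
  assumes "\<And>F. F \<in> \<F> \<Longrightarrow> pure_filter F"
  shows "pure_filter (filter_Join \<F>)"
proof (intro pure_filterI filter_filter_Join filter_Join_least filter_sigma)
  fix F assume "F \<in> \<F>"
  then show "F \<subseteq> sigma (filter_Join \<F>)"
    using assms sigma_mono[OF filter_Join_upper] by (metis pure_filter_def)
qed

lemma pure_pure_part: "pure_filter (pure_part F)"
  unfolding pure_part_def by (rule pure_filter_Join) blast

lemma filter_pure_part: "rl_filter (pure_part F)"
  using pure_pure_part pure_filter_def by blast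

lemma pure_part_subset: "rl_filter F \<Longrightarrow> pure_part F \<subseteq> F"
  unfolding pure_part_def by (rule filter_Join_least) auto

lemma pure_subset_pure_part: "pure_filter G \<Longrightarrow> G \<subseteq> F \<Longrightarrow> G \<subseteq> pure_part F"
  unfolding pure_part_def by (simp add: filter_Join_upper)

lemma pure_part_mono:
  assumes "rl_filter F" and "F \<subseteq> G"
  shows "pure_part F \<subseteq> pure_part G"
  using assms pure_subset_pure_part[OF pure_pure_part] pure_part_subset by blast

lemma pure_part_subset_sigma: "rl_filter F \<Longrightarrow> pure_part F \<subseteq> sigma F"
  using sigma_mono[OF pure_part_subset] pure_pure_part by (metis pure_filter_def)

section \<open>Maximal filters in Gelfand residuated lattices\<close>

text \<open>
  This is the union of the co-annihilators of the elements outside \<open>P\<close>. The union is directed because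
  \<open>P\<close> is prime: the co-annihilators of \<open>a\<close> and \<open>b\<close> are both contained in that of \<open>sup a b\<close>.
\<close>

lemma filter_split_outside_prime:
  assumes P: "P \<in> prime_filters"
  shows "rl_filter {d. \<exists>a. a \<notin> P \<and> sup a d = 1}"
proof (rule rl_filterI)
  show "1 \<in> {d. \<exists>a. a \<notin> P \<and> sup a d = 1}"
    using prime_filterD(2)[OF P] by (auto intro!: exI[of _ bot])
  fix x y assume x: "x \<in> {d. \<exists>a. a \<notin> P \<and> sup a d = 1}"
  then obtain a where a: "a \<notin> P" "sup a x = 1" by blast
  show "y \<in> {d. \<exists>a. a \<notin> P \<and> sup a d = 1}" if "x \<le> y"
  proof -
    have "1 \<le> sup a y" using a(2) that by (metis order_refl sup.mono)
    then show ?thesis using a(1) le_one order.antisym by blast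
  qed
  assume "y \<in> {d. \<exists>a. a \<notin> P \<and> sup a d = 1}"
  then obtain b where b: "b \<notin> P" "sup b y = 1" by blast
  have "sup x (sup a b) = 1" "sup y (sup a b) = 1"
    using a(2) b(2) sup_one_left by (metis sup_assoc sup_commute)+
  then have "1 \<le> sup (x * y) (sup a b)"
    using sup_mult_sup_le[of x "sup a b" y] by simp
  then have "sup (sup a b) (x * y) = 1"
    using le_one order.antisym by (metis sup_commute)
  moreover have "sup a b \<notin> P" using prime_filterD(3)[OF P] a(1) b(1) by blast
  ultimately show "x * y \<in> {d. \<exists>a. a \<notin> P \<and> sup a d = 1}" by blast
qed

text \<open>
  If \<open>F \<not>\<subseteq> M\<close>, then an \<open>a \<in> sigma F\<close> outside \<open>M\<close> is found through \<open>in_sigmaI\<close>: it suffices that \<open>F\<close> and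
  the filter of the preceding lemma have elements with product \<open>bot\<close>. If they had none, some maximal
  \<open>N\<close> would contain both filters and would have a prime below it in common with \<open>M\<close>.
\<close>

lemma gelfand_sigma_subset_maximal:
  fixes F :: "'a::residuated_lattice set"
  assumes gelfand: "gelfand TYPE('a)" and F: "rl_filter F"
    and M: "M \<in> maximal_filters" and sigma: "sigma F \<subseteq> M"
  shows "F \<subseteq> M"
proof (rule ccontr)
  assume notsub: "\<not> F \<subseteq> M"
  let ?D = "{d. \<exists>a. a \<notin> M \<and> sup a d = 1}"
  let ?H = "{z. \<exists>f\<in>F. \<exists>d\<in>?D. f * d \<le> z}"
  have Mp: "M \<in> prime_filters" by (rule maximal_filter_prime[OF M])
  have D: "rl_filter ?D" by (rule filter_split_outside_prime[OF Mp])
  have H: "rl_filter ?H" by (rule filter_products_above[OF F D])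
  have "bot \<notin> ?H"
  proof
    assume "bot \<in> ?H"
    then obtain f d a where "f \<in> F" "f * d \<le> bot" "a \<notin> M" "sup a d = 1" by blast
    then show False using in_sigmaI[of f F d a] sigma by (auto simp: le_bot)
  qed
  then obtain N where N: "N \<in> maximal_filters" and HN: "?H \<subseteq> N"
    using proper_filter_subset_maximal[OF H] by blast
  have FN: "F \<subseteq> N"
  proof
    fix f assume "f \<in> F"
    then have "f \<in> ?H" using one_in_filter[OF D] by (intro CollectI bexI[of _ f] bexI[of _ 1]) auto
    then show "f \<in> N" using HN by blast
  qed
  have DN: "?D \<subseteq> N"
  proof
    fix d assume "d \<in> ?D"
    then have "d \<in> ?H" using one_in_filter[OF F] by (intro CollectI bexI[of _ 1] bexI[of _ d]) auto
    then show "d \<in> N" using HN by blast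
  qed
  obtain R where "R \<in> prime_filters" "R \<subseteq> M" "R \<subseteq> N"
    by (rule common_prime_below[OF Mp maximal_filter_prime[OF N]]) (use DN in blast)
  then have "M = N" using gelfand_maximal_unique[OF gelfand] M N by blast
  then show False using FN notsub by blast
qed

text \<open>
  In the Gelfand case all primes below a given maximal filter, and only those, have it as the
  maximal filter above them. So \<open>sigma\<close> depends only on the maximal filters over its argument, and by
  the preceding lemma these are the same for \<open>F\<close> and \<open>sigma F\<close>.
\<close>

lemma gelfand_pure_sigma:
  fixes F :: "'a::residuated_lattice set"
  assumes gelfand: "gelfand TYPE('a)" and F: "rl_filter F"
  shows "pure_filter (sigma F)"
proof (intro pure_filterI filter_sigma subset_sigmaI)
  fix P Q :: "'a set"
  assume Q: "Q \<in> prime_filters" and P: "P \<in> prime_filters" and QP: "Q \<subseteq> P" and sub: "sigma F \<subseteq> P"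
  obtain M where M: "M \<in> maximal_filters" "P \<subseteq> M"
    using prime_filter_subset_maximal[OF P] .
  then have "F \<subseteq> M" using gelfand_sigma_subset_maximal[OF gelfand F] sub by blast
  then show "sigma F \<subseteq> Q"
    using sigma_subset_prime[OF Q maximal_filter_prime[OF M(1)]] QP M(2) by blast
qed

lemma gelfand_pure_part_subset_maximal:
  fixes F :: "'a::residuated_lattice set"
  assumes "gelfand TYPE('a)" and "rl_filter F" and "M \<in> maximal_filters" and "pure_part F \<subseteq> M"
  shows "F \<subseteq> M"
proof -
  have "sigma F \<subseteq> pure_part F"
    by (rule pure_subset_pure_part[OF gelfand_pure_sigma sigma_subset]) (use assms in auto)
  then show ?thesis using gelfand_sigma_subset_maximal assms by blast
qed

section \<open>From pure parts back to the Gelfand property\<close>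

text \<open>
  Write \<open>J\<close> for the join of the pure parts. It lies in the pure part of the join by monotonicity, and
  the assumption serves the reverse inclusion. A maximal filter over \<open>J\<close> contains each pure part, hence
  by assumption each \<open>F\<close>, and so the join of the family. Therefore \<open>sigma\<close> of that
  join, and with it the pure part, lies in \<open>sigma J\<close>, which is \<open>J\<close> by purity.
\<close>

lemma pure_part_filter_Join:
  fixes \<F> :: "'a::residuated_lattice set set"
  assumes detect: "\<And>F M :: 'a set. rl_filter F \<Longrightarrow> M \<in> maximal_filters \<Longrightarrow> pure_part F \<subseteq> M \<Longrightarrow> F \<subseteq> M"
    and \<F>: "\<And>F. F \<in> \<F> \<Longrightarrow> rl_filter F"
  shows "pure_part (filter_Join \<F>) = filter_Join (pure_part ` \<F>)"
proof
  let ?J = "filter_Join (pure_part ` \<F>)"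
  have "pure_filter ?J" by (rule pure_filter_Join) (use pure_pure_part in blast)
  then have J: "sigma ?J = ?J" by (simp add: pure_filter_def)
  have "sigma (filter_Join \<F>) \<subseteq> sigma ?J"
  proof (rule subset_sigmaI)
    fix P Q :: "'a set"
    assume Q: "Q \<in> prime_filters" and P: "P \<in> prime_filters" and QP: "Q \<subseteq> P" and JP: "?J \<subseteq> P"
    obtain M where M: "M \<in> maximal_filters" "P \<subseteq> M"
      using prime_filter_subset_maximal[OF P] .
    have "F \<subseteq> M" if "F \<in> \<F>" for F
    proof (rule detect[OF \<F>[OF that] M(1)])
      show "pure_part F \<subseteq> M"
        using filter_Join_upper[of "pure_part F" "pure_part ` \<F>"] that JP M(2) by blast
    qed
    then have "filter_Join \<F> \<subseteq> M"
      by (rule filter_Join_least) (use maximal_filterD(1)[OF M(1)] in auto)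
    then show "sigma (filter_Join \<F>) \<subseteq> Q"
      using sigma_subset_prime[OF Q maximal_filter_prime[OF M(1)]] QP M(2) by blast
  qed
  then show "pure_part (filter_Join \<F>) \<subseteq> ?J"
    using pure_part_subset_sigma[OF filter_filter_Join, of \<F>] J by simp
  show "?J \<subseteq> pure_part (filter_Join \<F>)"
  proof (rule filter_Join_least[OF _ filter_pure_part])
    fix G assume "G \<in> pure_part ` \<F>"
    then obtain F where F: "F \<in> \<F>" "G = pure_part F" by blast
    then show "G \<subseteq> pure_part (filter_Join \<F>)"
      using pure_part_mono[OF \<F>[OF F(1)] filter_Join_upper[OF F(1)]] by simp
  qed
qed

lemma comaximal_pure_partI:
  fixes F G :: "'a::residuated_lattice set"
  assumes "pure_part (filter_Join {F, G}) = filter_Join (pure_part ` {F, G})" and "comaximal F G"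
  shows "comaximal (pure_part F) (pure_part G)"
proof -
  have "pure_part (UNIV :: 'a set) = UNIV"
    using pure_subset_pure_part[OF pure_filter_UNIV] by blast
  then show ?thesis using assms by (simp add: comaximal_def)
qed

lemma distinct_maximal_comaximal:
  assumes M: "M \<in> maximal_filters" and N: "N \<in> maximal_filters" and "M \<noteq> N"
  shows "comaximal M N"
proof (rule ccontr)
  assume "\<not> comaximal M N"
  then have neq: "filter_Join {M, N} \<noteq> UNIV" by (simp add: comaximal_def)
  have "filter_Join {M, N} = M" "filter_Join {M, N} = N"
    by (intro maximal_filterD(3)[OF M] maximal_filterD(3)[OF N] filter_filter_Join neq
        filter_Join_upper; simp)+
  then show False using assms(3) by simp
qed

text \<open>A prime below \<open>M\<close> and \<open>N\<close> contains \<open>sigma M\<close> and \<open>sigma N\<close>, hence both pure parts.\<close>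

lemma gelfand_if_pure_parts_comaximal:
  assumes sep: "\<And>M N :: 'a::residuated_lattice set. M \<in> maximal_filters \<Longrightarrow> N \<in> maximal_filters \<Longrightarrow>
    M \<noteq> N \<Longrightarrow> comaximal (pure_part M) (pure_part N)"
  shows "gelfand TYPE('a)"
proof (rule gelfandI, rule ccontr)
  fix P M N :: "'a set"
  assume P: "P \<in> prime_filters" and M: "M \<in> maximal_filters" and N: "N \<in> maximal_filters"
    and sub: "P \<subseteq> M" "P \<subseteq> N" and "M \<noteq> N"
  have below: "pure_part K \<subseteq> P" if "K \<in> maximal_filters" "P \<subseteq> K" for K
    using pure_part_subset_sigma[OF maximal_filterD(1)[OF that(1)]]
      sigma_subset_prime[OF P maximal_filter_prime[OF that(1)] that(2) order_refl] by blast
  have "filter_Join {pure_part M, pure_part N} \<subseteq> P"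
    by (rule filter_Join_least) (use below M N sub prime_filterD(1)[OF P] in auto)
  then show False
    using sep[OF M N \<open>M \<noteq> N\<close>] prime_filterD(2)[OF P] unfolding comaximal_def by blast
qed

section \<open>The characterization\<close>

theorem theorem4p7:
  shows
    "(gelfand TYPE('a::residuated_lattice) \<longleftrightarrow>
        (\<forall>F M :: 'a set. rl_filter F \<and> M \<in> maximal_filters \<longrightarrow> pure_part F \<subseteq> M \<longrightarrow> F \<subseteq> M)) \<and>
     (gelfand TYPE('a) \<longleftrightarrow>
        (\<forall>F :: 'a set. rl_filter F \<longrightarrow>
           maximal_filters \<inter> hull_primes F = maximal_filters \<inter> hull_primes (pure_part F))) \<and>
     (gelfand TYPE('a) \<longleftrightarrow>
        (\<forall>F :: 'a set. rl_filter F \<longrightarrow> Rad F = Rad (pure_part F))) \<and>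
     (gelfand TYPE('a) \<longleftrightarrow>
        (\<forall>F G :: 'a set. rl_filter F \<and> rl_filter G \<and> comaximal F G \<longrightarrow>
           comaximal (pure_part F) (pure_part G))) \<and>
     (gelfand TYPE('a) \<longleftrightarrow>
        (\<forall>\<F> :: 'a set set. (\<forall>F\<in>\<F>. rl_filter F) \<longrightarrow>
           pure_part (filter_Join \<F>) = filter_Join (pure_part ` \<F>))) \<and>
     (gelfand TYPE('a) \<longleftrightarrow>
        (\<forall>M N :: 'a set. M \<in> maximal_filters \<and> N \<in> maximal_filters \<and> M \<noteq> N \<longrightarrow>
           comaximal (pure_part M) (pure_part N)))"
    (is "(?c1 \<longleftrightarrow> ?c2) \<and> (?c1 \<longleftrightarrow> ?c3) \<and> (?c1 \<longleftrightarrow> ?c4) \<and> (?c1 \<longleftrightarrow> ?c5) \<and> (?c1 \<longleftrightarrow> ?c6) \<and> (?c1 \<longleftrightarrow> ?c7)")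
proof -
  have c1_c2: ?c2 if ?c1
    by (intro allI impI, elim conjE) (rule gelfand_pure_part_subset_maximal[OF that])
  have c2_c3: ?c3 if ?c2
  proof (intro allI impI)
    fix F :: "'a set"
    assume F: "rl_filter F"
    have "F \<subseteq> M \<longleftrightarrow> pure_part F \<subseteq> M" if "M \<in> maximal_filters" for M
    proof
      show "pure_part F \<subseteq> M" if "F \<subseteq> M" using pure_part_subset[OF F] that by (rule order_trans)
      show "F \<subseteq> M" if "pure_part F \<subseteq> M"
        by (rule \<open>?c2\<close>[rule_format, OF conjI[OF F \<open>M \<in> maximal_filters\<close>] that])
    qed
    then show "maximal_filters \<inter> hull_primes F = maximal_filters \<inter> hull_primes (pure_part F)"
      by (auto simp: hull_primes_def)
  qed
  have c3_c4: ?c4 if ?c3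
  proof (intro allI impI)
    fix F :: "'a set"
    assume F: "rl_filter F"
    have over: "{M \<in> maximal_filters. G \<subseteq> M} = maximal_filters \<inter> hull_primes G" for G :: "'a set"
      using maximal_filter_prime by (auto simp: hull_primes_def)
    show "Rad F = Rad (pure_part F)" using that F by (simp add: Rad_def over)
  qed
  have c4_c2: ?c2 if ?c4
  proof (intro allI impI)
    fix F M :: "'a set"
    assume FM: "rl_filter F \<and> M \<in> maximal_filters" and sub: "pure_part F \<subseteq> M"
    have "F \<subseteq> Rad F" by (auto simp: Rad_def)
    also have "\<dots> = Rad (pure_part F)" by (rule that[rule_format]) (use FM in simp)
    also have "\<dots> \<subseteq> M" using FM sub by (auto simp: Rad_def)
    finally show "F \<subseteq> M" .
  qed
  have c2_c6: ?c6 if ?c2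
  proof (intro allI impI)
    fix \<F> :: "'a set set"
    assume "\<forall>F\<in>\<F>. rl_filter F"
    then show "pure_part (filter_Join \<F>) = filter_Join (pure_part ` \<F>)"
      by (intro pure_part_filter_Join) (simp_all add: that)
  qed
  have c6_c5: ?c5 if ?c6
  proof (intro allI impI, elim conjE)
    fix F G :: "'a set"
    assume "rl_filter F" "rl_filter G" and comax: "comaximal F G"
    then have "pure_part (filter_Join {F, G}) = filter_Join (pure_part ` {F, G})"
      by (intro that[rule_format]) auto
    then show "comaximal (pure_part F) (pure_part G)" using comax by (rule comaximal_pure_partI)
  qed
  have c5_c7: ?c7 if ?c5
    by (intro allI impI, elim conjE)
      (simp add: that distinct_maximal_comaximal maximal_filterD(1))
  have c7_c1: ?c1 if ?c7
    by (rule gelfand_if_pure_parts_comaximal) (simp add: that)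
  show ?thesis
    using c1_c2 c2_c3 c3_c4 c4_c2 c2_c6 c6_c5 c5_c7 c7_c1 by argo
qed

end
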